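(* Let $|q|<1$, $|\gamma|<1$ and $|x|<\frac{2}{\sqrt{1-q}}$. Then $$f_N(x|q)=f_R(x|\gamma,q)\sum_{k=0}^{\infty}(-\gamma)^kq^{k(k-1)/2}\,\frac{(\gamma)_k\,(1-\gamma q^{2k})}{(1-\gamma)\,[k]_q!\,(\gamma^2)_{2k}}\,R_{2k}(x|\gamma,q).$$
   Context: Notation: $[0]_q=0$, $[n]_q=1+q+\dots+q^{n-1}$, $[n]_q!=\prod_{i=1}^n[i]_q$, $[0]_q!=1$; $(a)_n=\prod_{i=0}^{n-1}(1-aq^i)$, $(a)_0=1$, $(a)_\infty=\prod_{i\ge0}(1-aq^i)$; $0^0=1$. The densities are $$f_N(x|q)=\frac{\sqrt{1-q}\,(q)_\infty}{2\pi\sqrt{4-(1-q)x^2}}\prod_{k=0}^\infty\left((1+q^k)^2-(1-q)x^2q^k\right),$$ $$f_R(x|\gamma,q)=\frac{\sqrt{1-q}\,(\gamma^2)_\infty(q)_\infty}{2\pi\sqrt{4-(1-q)x^2}\,(\gamma)_\infty(\gamma q)_\infty}\prod_{k=0}^\infty\frac{(1+q^k)^2-(1-q)x^2q^k}{(1+\gamma q^k)^2-(1-q)\gamma x^2q^k}.$$ Rogers polynomials: $R_{-1}(x|\gamma,q)=0$, $R_0(x|\gamma,q)=1$, $R_{n+1}(x|\gamma,q)=(1-\gamma q^n)xR_n(x|\gamma,q)-(1-\gamma^2q^{n-1})[n]_qR_{n-1}(x|\gamma,q)$ for $n\ge 0$ (the last term being $0$ for $n=0$). *)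

theory Defs
  imports "HOL-Analysis.Analysis"
begin

definition q_num :: "real \<Rightarrow> nat \<Rightarrow> real" where
  "q_num q n = (\<Sum>i<n. q ^ i)"

definition q_fact :: "real \<Rightarrow> nat \<Rightarrow> real" where
  "q_fact q n = (\<Prod>i=1..n. q_num q i)"

definition q_poch :: "real \<Rightarrow> real \<Rightarrow> nat \<Rightarrow> real" where
  "q_poch q a n = (\<Prod>i<n. 1 - a * q ^ i)"

(* For -1 < q < 1 this product, and those in f_N and f_R below for
  -1 < \<gamma> < 1 and (1 - q) x^2 < 4, converge in the sense of has_prod,
  so prodinf is their actual value. *)
definition q_poch_inf :: "real \<Rightarrow> real \<Rightarrow> real" where
  "q_poch_inf q a = (\<Prod>i. 1 - a * q ^ i)"

definition f_N :: "real \<Rightarrow> real \<Rightarrow> real" where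
  "f_N x q =
     sqrt (1 - q) * q_poch_inf q q / (2 * pi * sqrt (4 - (1 - q) * x ^ 2)) *
     (\<Prod>k. (1 + q ^ k) ^ 2 - (1 - q) * x ^ 2 * q ^ k)"

definition f_R :: "real \<Rightarrow> real \<Rightarrow> real \<Rightarrow> real" where
  "f_R x \<gamma> q =
     sqrt (1 - q) * q_poch_inf q (\<gamma> ^ 2) * q_poch_inf q q /
       (2 * pi * sqrt (4 - (1 - q) * x ^ 2) * q_poch_inf q \<gamma> * q_poch_inf q (\<gamma> * q)) *
     (\<Prod>k. ((1 + q ^ k) ^ 2 - (1 - q) * x ^ 2 * q ^ k) /
           ((1 + \<gamma> * q ^ k) ^ 2 - (1 - q) * \<gamma> * x ^ 2 * q ^ k))"

(* The convention R_{-1} = 0 is absorbed into the second equation, which is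
  the three-term recurrence at n = 0; the third is the recurrence at n + 1. *)
fun rogers :: "real \<Rightarrow> real \<Rightarrow> nat \<Rightarrow> real \<Rightarrow> real" where
  "rogers \<gamma> q 0 x = 1"
| "rogers \<gamma> q (Suc 0) x = (1 - \<gamma>) * x"
| "rogers \<gamma> q (Suc (Suc n)) x =
     (1 - \<gamma> * q ^ Suc n) * x * rogers \<gamma> q (Suc n) x -
     (1 - \<gamma> ^ 2 * q ^ n) * q_num q (Suc n) * rogers \<gamma> q n x"

definition expansion_term :: "real \<Rightarrow> real \<Rightarrow> real \<Rightarrow> nat \<Rightarrow> real" where
  "expansion_term x \<gamma> q k =
     (- \<gamma>) ^ k * q ^ (k * (k - 1) div 2) *
     (q_poch q \<gamma> k * (1 - \<gamma> * q ^ (2 * k)) /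
       ((1 - \<gamma>) * q_fact q k * q_poch q (\<gamma> ^ 2) (2 * k))) *
     rogers \<gamma> q (2 * k) x"

end

(* Write x = 2 cos(t) / sqrt(1 - q).  Cancelling the common factors of f_N and f_R, the claim is that the
   series S(\<gamma>) equals (\<gamma>)_inf (\<gamma> q)_inf / (\<gamma>^2)_inf times the product over k of W(\<gamma> q^k), where
   W(\<gamma>) = (1 + \<gamma>)^2 - (1 - q) \<gamma> x^2.
   The weights satisfy f_R(x | \<gamma> q) = const * W(\<gamma>) * f_R(x | \<gamma>), so by orthogonality W(\<gamma>) R_n(x | \<gamma> q) is a
   combination of R_n(x | \<gamma>) and R_{n+2}(x | \<gamma>) only; this two-term relation is proved directly from the
   recurrence.  Applied termwise it turns W(\<gamma>) S(\<gamma> q) into a multiple of S(\<gamma>) plus a telescoping series, which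
   vanishes.  Iterating \<gamma> -> \<gamma> q, the claim follows since S(\<gamma> q^n) -> 1, by the majorant C^k |q|^(k(k-1)/2). *)
theory Submission
  imports Defs
begin

section \<open>Two-term relation between Rogers polynomials at \<gamma> q and at \<gamma>\<close>

lemma q_num_closed: "(1 - q) * q_num q n = 1 - q ^ n"
  by (simp add: q_num_def one_diff_power_eq)

lemma abs_mult_power_less_one:
  fixes a q :: real assumes "\<bar>q\<bar> < 1" "\<bar>a\<bar> < 1" shows "\<bar>a * q ^ n\<bar> < 1"
proof -
  have "\<bar>a\<bar> * \<bar>q\<bar> ^ n \<le> \<bar>a\<bar> * 1"
    by (intro mult_left_mono power_le_one) (use assms in auto)
  then show ?thesis using assms by (simp add: abs_mult power_abs)
qed

text \<open>Proved by two-step induction from the three-term recurrences at both parameters. With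
  denominators cleared, the base cases and the step are polynomial identities.\<close>

lemma rogers_shift:
  assumes q: "\<bar>q\<bar> < 1" and g: "\<bar>\<gamma>\<bar> < 1"
  shows "(1 - \<gamma>) * (1 - \<gamma> * q ^ Suc n) * ((1 + \<gamma>)\<^sup>2 - (1 - q) * \<gamma> * x\<^sup>2) * rogers (\<gamma> * q) q n x =
    (1 - \<gamma>\<^sup>2 * q ^ n) * (1 - \<gamma>\<^sup>2 * q ^ Suc n) * rogers \<gamma> q n x
      - (1 - q) * \<gamma> * rogers \<gamma> q (Suc (Suc n)) x"
proof (induction n rule: induct_nat_012)
  case 0
  show ?case by (simp add: q_num_def) algebra
next
  case 1
  show ?case by (simp add: q_num_def lessThan_Suc) algebra
next
  case (ge2 n)
  define W where "W = (1 + \<gamma>)\<^sup>2 - (1 - q) * \<gamma> * x\<^sup>2"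
  define Q where "Q = q ^ n"
  define m where "m = q_num q (Suc n)"
  define r0 where "r0 = rogers (\<gamma> * q) q n x"
  define r1 where "r1 = rogers (\<gamma> * q) q (Suc n) x"
  define r2 where "r2 = rogers (\<gamma> * q) q (Suc (Suc n)) x"
  define A where "A = rogers \<gamma> q n x"
  define B where "B = rogers \<gamma> q (Suc n) x"
  define D where "D = rogers \<gamma> q (Suc (Suc n)) x"
  define E where "E = rogers \<gamma> q (Suc (Suc (Suc n))) x"
  define F where "F = rogers \<gamma> q (Suc (Suc (Suc (Suc n)))) x"
  \<comment> \<open>With \<open>Q\<close> and \<open>m\<close> treated as variables, this is the
    only relation between the power and the q-number that the final identity needs, so no symbolic
    exponent remains.\<close>
  have m: "(1 - q) * m = 1 - q * Q"
    unfolding m_def Q_def by (simp add: q_num_closed)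
  have m1: "q_num q (Suc (Suc n)) = m + q * Q"
    and m2: "q_num q (Suc (Suc (Suc n))) = m + q * Q + q\<^sup>2 * Q"
    by (simp_all add: m_def Q_def q_num_def power2_eq_square)
  have r2: "r2 = (1 - \<gamma> * q\<^sup>2 * Q) * x * r1 - (1 - \<gamma>\<^sup>2 * q\<^sup>2 * Q) * m * r0"
    unfolding r0_def r1_def r2_def by (simp add: m_def Q_def power2_eq_square mult_ac)
  have D: "D = (1 - \<gamma> * q * Q) * x * B - (1 - \<gamma>\<^sup>2 * Q) * m * A"
    unfolding A_def B_def D_def by (simp add: m_def Q_def power2_eq_square mult_ac)
  have E: "E = (1 - \<gamma> * q\<^sup>2 * Q) * x * D - (1 - \<gamma>\<^sup>2 * q * Q) * (m + q * Q) * B"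
    unfolding E_def B_def D_def rogers.simps(3)[of _ _ "Suc n"] m1
    by (simp add: Q_def power2_eq_square mult_ac)
  have F: "F = (1 - \<gamma> * q^3 * Q) * x * E - (1 - \<gamma>\<^sup>2 * q\<^sup>2 * Q) * (m + q * Q + q\<^sup>2 * Q) * D"
    unfolding E_def F_def D_def rogers.simps(3)[of _ _ "Suc (Suc n)"] m2
    by (simp add: Q_def power2_eq_square power3_eq_cube mult_ac)
  have IH0: "(1 - \<gamma>) * (1 - \<gamma> * q * Q) * W * r0 =
    (1 - \<gamma>\<^sup>2 * Q) * (1 - \<gamma>\<^sup>2 * q * Q) * A - (1 - q) * \<gamma> * D"
    using ge2 by (simp only: W_def Q_def r0_def A_def D_def power_Suc mult.assoc)
  have IH1: "(1 - \<gamma>) * (1 - \<gamma> * q\<^sup>2 * Q) * W * r1 =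
    (1 - \<gamma>\<^sup>2 * q * Q) * (1 - \<gamma>\<^sup>2 * q\<^sup>2 * Q) * B - (1 - q) * \<gamma> * E"
    using ge2 by (simp only: W_def Q_def r1_def B_def E_def power_Suc mult.assoc power2_eq_square)
  have nz: "1 - \<gamma> * q * Q \<noteq> 0"
    using abs_mult_power_less_one[OF q g, of "Suc n"] by (auto simp: Q_def)
  \<comment> \<open>The recurrence for \<open>r2\<close> already carries the factor
    \<open>1 - \<gamma> * q\<^sup>2 * Q\<close> that \<open>IH1\<close> requires next to
    \<open>r1\<close>. The extra factor \<open>1 - \<gamma> * q * Q\<close> supplies what
    \<open>IH0\<close> requires next to \<open>r0\<close>, and is cancelled at the end by
    \<open>nz\<close>.\<close>
  have "(1 - \<gamma> * q * Q) * ((1 - \<gamma>) * (1 - \<gamma> * q^3 * Q) * W * r2) =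
    (1 - \<gamma> * q^3 * Q) * ((1 - \<gamma> * q * Q) * x * ((1 - \<gamma>) * (1 - \<gamma> * q\<^sup>2 * Q) * W * r1)
       - (1 - \<gamma>\<^sup>2 * q\<^sup>2 * Q) * m * ((1 - \<gamma>) * (1 - \<gamma> * q * Q) * W * r0))"
    unfolding r2 by algebra
  also have "\<dots> = (1 - \<gamma> * q * Q) *
      ((1 - \<gamma>\<^sup>2 * q\<^sup>2 * Q) * (1 - \<gamma>\<^sup>2 * q^3 * Q) * D - (1 - q) * \<gamma> * F)"
    unfolding IH0 IH1 unfolding F using m D E by algebra
  finally have "(1 - \<gamma>) * (1 - \<gamma> * q^3 * Q) * W * r2 =
      (1 - \<gamma>\<^sup>2 * q\<^sup>2 * Q) * (1 - \<gamma>\<^sup>2 * q^3 * Q) * D - (1 - q) * \<gamma> * F"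
    using nz by (metis mult_left_cancel)
  then show ?case
    unfolding W_def Q_def r2_def D_def F_def
    by (simp only: power_Suc mult.assoc power2_eq_square power3_eq_cube)
qed

section \<open>Coefficients of the expansion: ratios in k and under \<gamma> -> \<gamma> q\<close>

text \<open>Split off from the polynomial so that both ratios are rational expressions free of
  x.\<close>

definition expansion_coeff :: "real \<Rightarrow> real \<Rightarrow> nat \<Rightarrow> real" where
  "expansion_coeff \<gamma> q k =
     (- \<gamma>) ^ k * q ^ (k * (k - 1) div 2) *
     (q_poch q \<gamma> k * (1 - \<gamma> * q ^ (2 * k)) /
       ((1 - \<gamma>) * q_fact q k * q_poch q (\<gamma>\<^sup>2) (2 * k)))"

lemma expansion_term_eq: "expansion_term x \<gamma> q k = expansion_coeff \<gamma> q k * rogers \<gamma> q (2 * k) x"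
  by (simp add: expansion_term_def expansion_coeff_def)

lemma abs_square_mult_power_less_one:
  fixes a q :: real assumes "\<bar>q\<bar> < 1" "\<bar>a\<bar> < 1" shows "\<bar>a\<^sup>2 * q ^ n\<bar> < 1"
  using abs_mult_power_less_one[of q "a\<^sup>2" n] assms by (simp add: power_less_one_iff abs_square_less_1)

text \<open>A bound uniform in n that also covers negative q, where the defining sum has mixed
  signs: \<open>1 - q ^ Suc n\<close> is at least \<open>1 - \<bar>q\<bar>\<close>, and
  \<open>1 - q\<close> is at most 2.\<close>

lemma q_num_ge:
  assumes "\<bar>q\<bar> < 1" shows "(1 - \<bar>q\<bar>) / 2 \<le> q_num q (Suc n)"
proof -
  have "\<bar>q\<bar> ^ Suc n \<le> \<bar>q\<bar> ^ 1"
    using assms by (intro power_decreasing) auto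
  then have "q ^ Suc n \<le> \<bar>q\<bar>"
    by (metis abs_ge_self order_trans power_abs power_one_right)
  then have "1 - \<bar>q\<bar> \<le> (1 - q) * q_num q (Suc n)"
    unfolding q_num_closed by simp
  moreover from this have pos: "0 < q_num q (Suc n)"
    using assms by (smt (verit) zero_less_mult_pos)
  moreover have "(1 - q) * q_num q (Suc n) \<le> 2 * q_num q (Suc n)"
    using assms pos by (intro mult_right_mono) auto
  ultimately have "1 - \<bar>q\<bar> \<le> 2 * q_num q (Suc n)" by (meson order_trans)
  then show ?thesis by simp
qed

lemma q_num_pos: "\<bar>q\<bar> < 1 \<Longrightarrow> 0 < q_num q (Suc n)"
  using q_num_ge[of q n] by (smt (verit) divide_pos_pos)

lemma q_fact_Suc: "q_fact q (Suc n) = q_fact q n * q_num q (Suc n)"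
  by (simp add: q_fact_def)

lemma q_fact_pos: "\<bar>q\<bar> < 1 \<Longrightarrow> 0 < q_fact q n"
  by (induction n) (simp_all add: q_fact_Suc q_num_pos, simp add: q_fact_def)

lemma q_poch_Suc: "q_poch q a (Suc n) = q_poch q a n * (1 - a * q ^ n)"
  by (simp add: q_poch_def)

text \<open>Both sides are \<open>q_poch q a (Suc n)\<close>, with the first or the last factor
  split off.\<close>

lemma q_poch_shift: "(1 - a) * q_poch q (a * q) n = q_poch q a n * (1 - a * q ^ n)"
  by (induction n) (simp_all add: q_poch_Suc mult_ac, simp add: q_poch_def)

lemma q_poch_pos: "\<bar>q\<bar> < 1 \<Longrightarrow> \<bar>a\<bar> < 1 \<Longrightarrow> 0 < q_poch q a n"
  unfolding q_poch_def using abs_mult_power_less_one[of q a] by (intro prod_pos) (smt (verit))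

text \<open>This ratio serves twice: it identifies the upper boundary term in the telescoping, and
  it yields the bound on the coefficients.\<close>

lemma expansion_coeff_Suc:
  assumes q: "\<bar>q\<bar> < 1" and g: "\<bar>\<gamma>\<bar> < 1"
  shows "expansion_coeff \<gamma> q (Suc k) = expansion_coeff \<gamma> q k *
    ((- \<gamma> * q ^ k * (1 - \<gamma> * q ^ k) * (1 - \<gamma> * q ^ (2 * Suc k))) /
     ((1 - \<gamma> * q ^ (2 * k)) * q_num q (Suc k) *
      (1 - \<gamma>\<^sup>2 * q ^ (2 * k)) * (1 - \<gamma>\<^sup>2 * q ^ Suc (2 * k))))"
proof -
  have tri: "Suc k * (Suc k - 1) div 2 = k * (k - 1) div 2 + k"
    by (cases k) (simp_all add: algebra_simps)
  have "1 - \<gamma> * q ^ (2 * k) \<noteq> 0"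
    using abs_mult_power_less_one[OF q g, of "2 * k"] by auto
  moreover have "2 * Suc k = Suc (Suc (2 * k))"
    by simp
  ultimately show ?thesis
    unfolding expansion_coeff_def tri power_add by (simp add: q_fact_Suc q_poch_Suc) (simp only: mult_ac)
qed

lemma expansion_coeff_shift:
  assumes q: "\<bar>q\<bar> < 1" and g: "\<bar>\<gamma>\<bar> < 1"
  shows "(1 - \<gamma> * q) * expansion_coeff (\<gamma> * q) q k = expansion_coeff \<gamma> q k *
    (q ^ k * (1 - \<gamma> * q ^ k) * (1 - \<gamma> * q ^ Suc (2 * k)) * ((1 - \<gamma>\<^sup>2) * (1 - \<gamma>\<^sup>2 * q)) /
     ((1 - \<gamma> * q ^ (2 * k)) * (1 - \<gamma>\<^sup>2 * q ^ (2 * k)) * (1 - \<gamma>\<^sup>2 * q ^ Suc (2 * k))))"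
proof -
  have gq: "\<bar>\<gamma> * q\<bar> < 1" and g2: "\<bar>\<gamma>\<^sup>2\<bar> < 1" and g2q: "\<bar>\<gamma>\<^sup>2 * q\<bar> < 1"
    using abs_mult_power_less_one[OF q g, of 1] abs_square_mult_power_less_one[OF q g, of 0]
      abs_square_mult_power_less_one[OF q g, of 1]
    by simp_all
  have 1: "q_poch q (\<gamma> * q) k = q_poch q \<gamma> k * (1 - \<gamma> * q ^ k) / (1 - \<gamma>)"
    using q_poch_shift[of \<gamma> q k] g by (simp add: field_simps)
  \<comment> \<open>Replacing \<gamma> by \<gamma> q multiplies the base of this symbol by q twice,
    hence two uses of \<open>q_poch_shift\<close>.\<close>
  have "(1 - \<gamma>\<^sup>2) * ((1 - \<gamma>\<^sup>2 * q) * q_poch q (\<gamma>\<^sup>2 * q * q) (2 * k)) =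
      q_poch q (\<gamma>\<^sup>2) (2 * k) * (1 - \<gamma>\<^sup>2 * q ^ (2 * k)) * (1 - \<gamma>\<^sup>2 * q ^ Suc (2 * k))"
    by (simp add: q_poch_shift flip: mult.assoc)
  then have 2: "q_poch q ((\<gamma> * q)\<^sup>2) (2 * k) = q_poch q (\<gamma>\<^sup>2) (2 * k) *
      (1 - \<gamma>\<^sup>2 * q ^ (2 * k)) * (1 - \<gamma>\<^sup>2 * q ^ Suc (2 * k)) / ((1 - \<gamma>\<^sup>2) * (1 - \<gamma>\<^sup>2 * q))"
    using g2 g2q by (simp add: power_mult_distrib power2_eq_square eq_divide_eq mult_ac)
  define P where "P = q_poch q (\<gamma>\<^sup>2) (2 * k)"
  define X where "X = 1 - \<gamma>\<^sup>2 * q ^ (2 * k)"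
  define Y where "Y = 1 - \<gamma>\<^sup>2 * q ^ Suc (2 * k)"
  define V where "V = 1 - \<gamma> * q ^ (2 * k)"
  have nz: "P \<noteq> 0" "X \<noteq> 0" "Y \<noteq> 0" "V \<noteq> 0" "q_fact q k \<noteq> 0" "1 - \<gamma> \<noteq> 0" "1 - \<gamma> * q \<noteq> 0"
    "1 - \<gamma>\<^sup>2 \<noteq> 0" "1 - \<gamma>\<^sup>2 * q \<noteq> 0"
    using q_poch_pos[OF q g2, of "2 * k"] q_fact_pos[OF q, of k] g gq g2 g2q
      abs_square_mult_power_less_one[OF q g, of "2 * k"] abs_mult_power_less_one[OF q g, of "2 * k"]
      abs_square_mult_power_less_one[OF q g, of "Suc (2 * k)"]
    unfolding P_def X_def Y_def V_def by (smt (verit))+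
  have 3: "1 - \<gamma> * q * q ^ (2 * k) = 1 - \<gamma> * q ^ Suc (2 * k)" "(- (\<gamma> * q)) ^ k = (- \<gamma>) ^ k * q ^ k"
    by (simp_all flip: power_mult_distrib)
  show ?thesis
    unfolding expansion_coeff_def 1 2 3 P_def[symmetric] X_def[symmetric] Y_def[symmetric] V_def[symmetric]
    using nz by (simp add: divide_simps)
qed

section \<open>Termwise telescoping\<close>

text \<open>The antidifference for the error left by the two-term relation. It vanishes at k = 0
  because of the factor \<open>1 - q ^ k\<close>.\<close>

definition boundary_term :: "real \<Rightarrow> real \<Rightarrow> real \<Rightarrow> nat \<Rightarrow> real" where
  "boundary_term x \<gamma> q k = (1 - q ^ k) / (1 - \<gamma> * q ^ (2 * k)) * expansion_term x \<gamma> q k"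

text \<open>\<open>rogers_shift\<close> at index 2k produces a part in \<open>A\<close> and a part
  in \<open>B\<close>. The first is the term of the series minus its boundary term, the second is
  the next boundary term.\<close>

lemma expansion_term_shift:
  assumes q: "\<bar>q\<bar> < 1" and g: "\<bar>\<gamma>\<bar> < 1"
  shows "(1 - \<gamma>) * (1 - \<gamma> * q) * ((1 + \<gamma>)\<^sup>2 - (1 - q) * \<gamma> * x\<^sup>2) * expansion_term x (\<gamma> * q) q k =
    (1 - \<gamma>\<^sup>2) * (1 - \<gamma>\<^sup>2 * q) *
      (expansion_term x \<gamma> q k + (boundary_term x \<gamma> q (Suc k) - boundary_term x \<gamma> q k))"
proof -
  define W where "W = (1 + \<gamma>)\<^sup>2 - (1 - q) * \<gamma> * x\<^sup>2"
  define K where "K = (1 - \<gamma>\<^sup>2) * (1 - \<gamma>\<^sup>2 * q)"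
  define X where "X = 1 - \<gamma>\<^sup>2 * q ^ (2 * k)"
  define Y where "Y = 1 - \<gamma>\<^sup>2 * q ^ Suc (2 * k)"
  define V0 where "V0 = 1 - \<gamma> * q ^ (2 * k)"
  define V1 where "V1 = 1 - \<gamma> * q ^ Suc (2 * k)"
  define V2 where "V2 = 1 - \<gamma> * q ^ (2 * Suc k)"
  define U where "U = 1 - \<gamma> * q ^ k"
  define m where "m = q_num q (Suc k)"
  define e where "e = expansion_coeff \<gamma> q k"
  define r where "r = rogers (\<gamma> * q) q (2 * k) x"
  define A where "A = rogers \<gamma> q (2 * k) x"
  define B where "B = rogers \<gamma> q (2 * Suc k) x"
  note defs = W_def K_def X_def Y_def V0_def V1_def V2_def U_def m_def e_def r_def A_def B_def
  have nz: "X \<noteq> 0" "Y \<noteq> 0" "V0 \<noteq> 0" "V1 \<noteq> 0" "V2 \<noteq> 0" "m \<noteq> 0"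
    using abs_square_mult_power_less_one[OF q g, of "2 * k"] abs_mult_power_less_one[OF q g, of "2 * k"]
      abs_square_mult_power_less_one[OF q g, of "Suc (2 * k)"]
      abs_mult_power_less_one[OF q g, of "Suc (2 * k)"] abs_mult_power_less_one[OF q g, of "2 * Suc k"]
      q_num_pos[OF q, of k]
    unfolding defs by (smt (verit))+
  \<comment> \<open>The numerator of the next boundary term: \<open>1 - q\<close> comes from
    \<open>rogers_shift\<close>, and \<open>m\<close> cancels the q-number in the denominator of
    \<open>expansion_coeff_Suc\<close>.\<close>
  have m: "1 - q ^ Suc k = (1 - q) * m"
    unfolding m_def q_num_closed ..
  have shift: "(1 - \<gamma>) * V1 * W * r = X * Y * A - (1 - q) * \<gamma> * B"
    using rogers_shift[OF q g, of "2 * k" x] by (simp add: defs)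
  have "(1 - \<gamma>) * (1 - \<gamma> * q) * W * expansion_term x (\<gamma> * q) q k =
      ((1 - \<gamma> * q) * expansion_coeff (\<gamma> * q) q k) * ((1 - \<gamma>) * W * r)"
    by (simp add: expansion_term_eq r_def)
  also have "\<dots> = e * (q ^ k * U * K / (V0 * X * Y)) * ((1 - \<gamma>) * V1 * W * r)"
    unfolding expansion_coeff_shift[OF q g] by (simp add: defs)
  also have "\<dots> = K * (e * (q ^ k * U / V0) * A - (1 - q) * m / V2 *
      (e * (\<gamma> * q ^ k * U * V2 / (V0 * m * X * Y)) * B))"
    unfolding shift using nz by (simp add: field_simps)
  \<comment> \<open>Here the coefficient of \<open>A\<close> separates into the original term and
    the boundary term at k.\<close>
  also have "(q ^ k * U / V0) = 1 - (1 - q ^ k) / V0"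
    using nz by (simp add: field_simps U_def) (simp add: V0_def mult_2 mult_2_right power_add algebra_simps)
  also have "e * (\<gamma> * q ^ k * U * V2 / (V0 * m * X * Y)) = - expansion_coeff \<gamma> q (Suc k)"
    unfolding expansion_coeff_Suc[OF q g] by (simp add: defs)
  finally show ?thesis
    unfolding boundary_term_def expansion_term_eq m
    by (simp add: W_def K_def e_def A_def B_def V0_def V2_def algebra_simps)
qed

section \<open>Majorants, summability and the limit of the series along \<gamma> q^n\<close>

text \<open>The base does not depend on \<gamma>, so the bound applies at every \<gamma> q^n alike.
  In the recurrence each factor involving \<gamma> is at most 2 in absolute value and the q-numbers
  are bounded by a geometric series; as the base is at least 1, the induction closes.\<close>

lemma rogers_bound:
  assumes q: "\<bar>q\<bar> < 1" and g: "\<bar>\<gamma>\<bar> < 1"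
  shows "\<bar>rogers \<gamma> q n x\<bar> \<le> (2 * \<bar>x\<bar> + 4 / (1 - \<bar>q\<bar>)) ^ n"
proof -
  define L where "L = 4 / (1 - \<bar>q\<bar>)"
  define M where "M = 2 * \<bar>x\<bar> + L"
  have L: "4 \<le> L"
    using q unfolding L_def by (simp add: field_simps)
  then have M: "1 \<le> M"
    by (simp add: M_def)
  have g_le: "\<bar>1 - \<gamma> * q ^ i\<bar> \<le> 2" and g2_le: "\<bar>1 - \<gamma>\<^sup>2 * q ^ i\<bar> \<le> 2" for i
    using abs_mult_power_less_one[OF q g, of i] abs_square_mult_power_less_one[OF q g, of i]
    by linarith+
  have num_le: "\<bar>q_num q i\<bar> \<le> L / 2" for i
  proof -
    have "\<bar>q_num q i\<bar> \<le> (\<Sum>j<i. \<bar>q\<bar> ^ j)"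
      unfolding q_num_def by (rule order_trans[OF sum_abs]) (simp add: power_abs)
    also have "\<dots> \<le> (\<Sum>j. \<bar>q\<bar> ^ j)"
      by (intro sum_le_suminf summable_geometric) (use q in auto)
    also have "\<dots> \<le> L / 2"
      using q by (simp add: suminf_geometric L_def field_simps)
    finally show ?thesis .
  qed
  have "\<bar>rogers \<gamma> q n x\<bar> \<le> M ^ n"
  proof (induction n rule: induct_nat_012)
    case 0
    show ?case by simp
  next
    case 1
    have "\<bar>1 - \<gamma>\<bar> * \<bar>x\<bar> \<le> 2 * \<bar>x\<bar>"
      using g by (intro mult_right_mono) auto
    then show ?case using L by (simp add: M_def abs_mult)
  next
    case (ge2 n)
    have "\<bar>rogers \<gamma> q (Suc (Suc n)) x\<bar> \<le>
        \<bar>1 - \<gamma> * q ^ Suc n\<bar> * \<bar>x\<bar> * \<bar>rogers \<gamma> q (Suc n) x\<bar> +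
        \<bar>1 - \<gamma>\<^sup>2 * q ^ n\<bar> * \<bar>q_num q (Suc n)\<bar> * \<bar>rogers \<gamma> q n x\<bar>"
      unfolding rogers.simps abs_mult[symmetric] by (rule abs_triangle_ineq4)
    also have "\<dots> \<le> 2 * \<bar>x\<bar> * M ^ Suc n + 2 * (L / 2) * M ^ n"
      using ge2 L by (intro add_mono mult_mono g_le g2_le num_le) auto
    also have "2 * (L / 2) * M ^ n \<le> L * M ^ Suc n"
      using L M by (simp add: mult_left_mono power_increasing)
    finally show ?case
      by (simp add: M_def algebra_simps)
  qed
  then show ?thesis by (simp add: M_def L_def)
qed

text \<open>Bounds the successive ratios uniformly for \<open>\<bar>h\<bar> \<le> G\<close>. The 8
  collects two numerator factors at most 2 and the 1/2 from \<open>q_num_ge\<close>; three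
  denominator factors are at least 1 - G. The factor \<open>\<bar>h\<bar>\<close> is retained to
  control the limit h -> 0.\<close>

lemma expansion_coeff_bound:
  assumes q: "\<bar>q\<bar> < 1" and G: "G < 1" and h: "\<bar>h\<bar> \<le> G"
  shows "\<bar>expansion_coeff h q k\<bar> \<le> (\<Prod>i<k. \<bar>h\<bar> * (8 / ((1 - \<bar>q\<bar>) * (1 - G) ^ 3) * \<bar>q\<bar> ^ i))"
proof (induction k)
  case 0
  show ?case using h G by (simp add: expansion_coeff_def q_fact_def q_poch_def)
next
  case (Suc k)
  have h1: "\<bar>h\<bar> < 1" using h G by simp
  have ge: "1 - G \<le> \<bar>1 - h * q ^ i\<bar>" "1 - G \<le> \<bar>1 - h\<^sup>2 * q ^ i\<bar>"
    and le: "\<bar>1 - h * q ^ i\<bar> \<le> 2" for i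
  proof -
    have "\<bar>q\<bar> ^ i \<le> 1" and "\<bar>h\<bar>\<^sup>2 \<le> \<bar>h\<bar>"
      using q h1 mult_left_le[of "\<bar>h\<bar>" "\<bar>h\<bar>"] by (auto intro: power_le_one simp: power2_eq_square)
    then have "\<bar>h\<bar> * \<bar>q\<bar> ^ i \<le> \<bar>h\<bar> * 1" "\<bar>h\<bar>\<^sup>2 * \<bar>q\<bar> ^ i \<le> \<bar>h\<bar> * 1"
      by (intro mult_mono; simp)+
    then have "\<bar>h * q ^ i\<bar> \<le> G" "\<bar>h\<^sup>2 * q ^ i\<bar> \<le> G"
      using h by (simp_all add: abs_mult power_abs)
    then show "1 - G \<le> \<bar>1 - h * q ^ i\<bar>" "1 - G \<le> \<bar>1 - h\<^sup>2 * q ^ i\<bar>" "\<bar>1 - h * q ^ i\<bar> \<le> 2"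
      using G by linarith+
  qed
  have num: "(1 - \<bar>q\<bar>) / 2 \<le> \<bar>q_num q (Suc k)\<bar>"
    using q_num_ge[OF q, of k] by linarith
  have "\<bar>(- h * q ^ k * (1 - h * q ^ k) * (1 - h * q ^ (2 * Suc k))) /
     ((1 - h * q ^ (2 * k)) * q_num q (Suc k) *
      (1 - h\<^sup>2 * q ^ (2 * k)) * (1 - h\<^sup>2 * q ^ Suc (2 * k)))\<bar> \<le>
     (\<bar>h\<bar> * \<bar>q\<bar> ^ k * 2 * 2) / ((1 - G) * ((1 - \<bar>q\<bar>) / 2) * (1 - G) * (1 - G))"
    unfolding abs_divide abs_mult abs_minus_cancel power_abs
    using G q by (intro frac_le mult_mono ge le num) auto
  also have "\<dots> = \<bar>h\<bar> * (8 / ((1 - \<bar>q\<bar>) * (1 - G) ^ 3) * \<bar>q\<bar> ^ k)"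
    by (simp add: power3_eq_cube mult_ac)
  finally show ?case
    unfolding expansion_coeff_Suc[OF q h1] abs_mult[of "expansion_coeff h q k"] prod.lessThan_Suc
    by (intro mult_mono Suc.IH) (use G q in \<open>auto intro!: prod_nonneg\<close>)
qed

text \<open>The ratio of consecutive terms is \<open>c * r ^ n\<close>, which tends to 0 whatever
  the size of c.\<close>

lemma summable_prod_geometric:
  fixes c r :: real
  assumes "\<bar>r\<bar> < 1"
  shows "summable (\<lambda>k. \<Prod>i<k. c * r ^ i)"
proof -
  have "(\<lambda>n. \<bar>c * r ^ n\<bar>) \<longlonglongrightarrow> 0"
    using assms by (intro tendsto_rabs_zero tendsto_mult_right_zero LIMSEQ_power_zero) auto
  then have "\<forall>\<^sub>F n in sequentially. \<bar>c * r ^ n\<bar> < 1 / 2"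
    by (rule order_tendstoD) simp
  then obtain N where N: "\<And>n. n \<ge> N \<Longrightarrow> \<bar>c * r ^ n\<bar> < 1 / 2"
    by (auto simp: eventually_sequentially)
  show ?thesis
  proof (rule summable_ratio_test)
    fix n assume "n \<ge> N"
    then have "\<bar>\<Prod>i<n. c * r ^ i\<bar> * \<bar>c * r ^ n\<bar> \<le> \<bar>\<Prod>i<n. c * r ^ i\<bar> * (1 / 2)"
      by (intro mult_left_mono less_imp_le[OF N] abs_ge_zero)
    then show "norm (\<Prod>i<Suc n. c * r ^ i) \<le> 1 / 2 * norm (\<Prod>i<n. c * r ^ i)"
      by (simp add: abs_mult)
  qed simp
qed

text \<open>Separates the dependence on h, as a power, from a summable sequence that is the same for
  all admissible h.\<close>

lemma expansion_term_majorant: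
  assumes q: "\<bar>q\<bar> < 1" and G: "G < 1"
  obtains v where "summable v" and "\<And>k. 0 \<le> v k"
    and "\<And>h k. \<bar>h\<bar> \<le> G \<Longrightarrow> \<bar>expansion_term x h q k\<bar> \<le> \<bar>h\<bar> ^ k * v k"
proof -
  define C where "C = 8 / ((1 - \<bar>q\<bar>) * (1 - G) ^ 3)"
  define M where "M = 2 * \<bar>x\<bar> + 4 / (1 - \<bar>q\<bar>)"
  have C: "0 \<le> C" and M: "0 \<le> M"
    using q G by (simp_all add: C_def M_def)
  show thesis
  proof
    show "summable (\<lambda>k. \<Prod>i<k. (C * M\<^sup>2) * \<bar>q\<bar> ^ i)"
      using q by (intro summable_prod_geometric) auto
    show "0 \<le> (\<Prod>i<k. (C * M\<^sup>2) * \<bar>q\<bar> ^ i)" for k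
      using C by (intro prod_nonneg) auto
    fix h k assume h: "\<bar>h\<bar> \<le> G"
    have "\<bar>expansion_term x h q k\<bar> \<le> (\<Prod>i<k. \<bar>h\<bar> * (C * \<bar>q\<bar> ^ i)) * M ^ (2 * k)"
      unfolding expansion_term_eq abs_mult
      using expansion_coeff_bound[OF q G h, of k] rogers_bound[OF q, of h "2 * k" x] h G C
      by (intro mult_mono) (auto intro!: prod_nonneg simp: C_def M_def)
    \<comment> \<open>The polynomial bound \<open>M ^ (2 * k)\<close> is absorbed into the product
      as one factor \<open>M\<^sup>2\<close> for each index.\<close>
    also have "\<dots> = \<bar>h\<bar> ^ k * (\<Prod>i<k. (C * M\<^sup>2) * \<bar>q\<bar> ^ i)"
      by (simp add: prod.distrib power_mult power_mult_distrib)
    finally show "\<bar>expansion_term x h q k\<bar> \<le> \<bar>h\<bar> ^ k * (\<Prod>i<k. (C * M\<^sup>2) * \<bar>q\<bar> ^ i)" .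
  qed
qed

lemma summable_expansion_term:
  assumes q: "\<bar>q\<bar> < 1" and g: "\<bar>\<gamma>\<bar> < 1"
  shows "summable (expansion_term x \<gamma> q)"
proof -
  obtain v where v: "summable v" "\<And>k. 0 \<le> v k"
    "\<And>h k. \<bar>h\<bar> \<le> \<bar>\<gamma>\<bar> \<Longrightarrow> \<bar>expansion_term x h q k\<bar> \<le> \<bar>h\<bar> ^ k * v k"
    using expansion_term_majorant[OF q g] by blast
  have "\<bar>\<gamma>\<bar> ^ k * v k \<le> 1 * v k" for k
    using g v(2) by (intro mult_right_mono power_le_one) auto
  then show ?thesis
    using v(3)[of \<gamma>] by (intro summable_comparison_test'[OF v(1)]) (fastforce intro: order_trans)
qed

text \<open>The term k = 0 equals 1, and every later term carries at least one factor
  \<open>\<bar>\<gamma> * q ^ n\<bar>\<close>, so the distance to 1 is at most a constant times that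
  factor.\<close>

lemma expansion_sum_tendsto_one:
  assumes q: "\<bar>q\<bar> < 1" and g: "\<bar>\<gamma>\<bar> < 1"
  shows "(\<lambda>n. \<Sum>k. expansion_term x (\<gamma> * q ^ n) q k) \<longlonglongrightarrow> 1"
proof -
  obtain v where v: "summable v" "\<And>k. 0 \<le> v k"
    "\<And>h k. \<bar>h\<bar> \<le> \<bar>\<gamma>\<bar> \<Longrightarrow> \<bar>expansion_term x h q k\<bar> \<le> \<bar>h\<bar> ^ k * v k"
    using expansion_term_majorant[OF q g] by blast
  have v': "summable (\<lambda>k. v (Suc k))"
    using v(1) by (simp add: summable_Suc_iff)
  have bound: "\<bar>(\<Sum>k. expansion_term x (\<gamma> * q ^ n) q k) - 1\<bar> \<le> \<bar>\<gamma> * q ^ n\<bar> * (\<Sum>k. v (Suc k))" for n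
  proof -
    define h where "h = \<gamma> * q ^ n"
    have "\<bar>\<gamma>\<bar> * \<bar>q\<bar> ^ n \<le> \<bar>\<gamma>\<bar> * 1"
      using q by (intro mult_left_mono power_le_one) auto
    then have h: "\<bar>h\<bar> \<le> \<bar>\<gamma>\<bar>" and h1: "\<bar>h\<bar> < 1"
      using g by (auto simp: h_def abs_mult power_abs)
    have le: "norm (expansion_term x h q (Suc k)) \<le> \<bar>h\<bar> * v (Suc k)" for k
    proof -
      have "\<bar>h\<bar> ^ Suc k * v (Suc k) \<le> \<bar>h\<bar> ^ 1 * v (Suc k)"
        using h1 v(2) by (intro mult_right_mono power_decreasing) auto
      then show ?thesis
        using v(3)[OF h, of "Suc k"] by simp
    qed
    have "expansion_term x h q 0 = 1"
      using h1 by (simp add: expansion_term_def q_poch_def q_fact_def)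
    then have "(\<Sum>k. expansion_term x h q k) - 1 = (\<Sum>k. expansion_term x h q (Suc k))"
      using suminf_split_head[OF summable_expansion_term[OF q h1]] by simp
    moreover have "norm (\<Sum>k. expansion_term x h q (Suc k)) \<le> (\<Sum>k. \<bar>h\<bar> * v (Suc k))"
      by (rule norm_suminf_le[OF le]) (intro summable_mult v')
    ultimately show ?thesis
      by (simp add: suminf_mult[OF v'] h_def)
  qed
  have "(\<lambda>n. \<bar>\<gamma> * q ^ n\<bar> * (\<Sum>k. v (Suc k))) \<longlonglongrightarrow> 0"
    using q by (intro tendsto_mult_left_zero tendsto_rabs_zero tendsto_mult_right_zero
        LIMSEQ_power_zero) auto
  then have "(\<lambda>n. (\<Sum>k. expansion_term x (\<gamma> * q ^ n) q k) - 1) \<longlonglongrightarrow> 0"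
    by (rule Lim_null_comparison[rotated]) (use bound in \<open>auto intro: always_eventually\<close>)
  then show ?thesis
    by (simp add: LIM_zero_iff)
qed

section \<open>Functional equation of the series and its iteration\<close>

text \<open>Summing \<open>expansion_term_shift\<close> over k leaves no boundary contribution: the
  boundary terms start at 0 and tend to 0.\<close>

lemma expansion_sum_shift:
  assumes q: "\<bar>q\<bar> < 1" and g: "\<bar>\<gamma>\<bar> < 1"
  shows "(1 - \<gamma>) * (1 - \<gamma> * q) * ((1 + \<gamma>)\<^sup>2 - (1 - q) * \<gamma> * x\<^sup>2) * (\<Sum>k. expansion_term x (\<gamma> * q) q k) =
    (1 - \<gamma>\<^sup>2) * (1 - \<gamma>\<^sup>2 * q) * (\<Sum>k. expansion_term x \<gamma> q k)"
proof -
  have gq: "\<bar>\<gamma> * q\<bar> < 1"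
    using abs_mult_power_less_one[OF q g, of 1] by simp
  have lim: "boundary_term x \<gamma> q \<longlonglongrightarrow> 0"
  proof -
    \<comment> \<open>The rational prefactor tends to 1, and the terms of a convergent series tend
      to 0.\<close>
    have "(\<lambda>k. (1 - q ^ k) / (1 - \<gamma> * (q ^ k)\<^sup>2) * expansion_term x \<gamma> q k) \<longlonglongrightarrow>
        (1 - 0) / (1 - \<gamma> * 0\<^sup>2) * 0"
      using q by (intro tendsto_intros LIMSEQ_power_zero
          summable_LIMSEQ_zero[OF summable_expansion_term[OF q g]]) auto
    moreover have "q ^ (2 * k) = (q ^ k)\<^sup>2" for k
      by (simp add: mult.commute flip: power_mult)
    ultimately show ?thesis
      by (simp add: boundary_term_def[abs_def])
  qed
  have "(\<lambda>k. expansion_term x \<gamma> q k + (boundary_term x \<gamma> q (Suc k) - boundary_term x \<gamma> q k)) sums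
      ((\<Sum>k. expansion_term x \<gamma> q k) + (0 - boundary_term x \<gamma> q 0))"
    by (intro sums_add telescope_sums lim summable_sums summable_expansion_term q g)
  then have "(\<lambda>k. (1 - \<gamma>\<^sup>2) * (1 - \<gamma>\<^sup>2 * q) *
      (expansion_term x \<gamma> q k + (boundary_term x \<gamma> q (Suc k) - boundary_term x \<gamma> q k))) sums
      ((1 - \<gamma>\<^sup>2) * (1 - \<gamma>\<^sup>2 * q) * (\<Sum>k. expansion_term x \<gamma> q k))"
    by (intro sums_mult) (simp add: boundary_term_def)
  moreover have "(\<lambda>k. (1 - \<gamma>) * (1 - \<gamma> * q) * ((1 + \<gamma>)\<^sup>2 - (1 - q) * \<gamma> * x\<^sup>2) *
      expansion_term x (\<gamma> * q) q k) sums
      ((1 - \<gamma>) * (1 - \<gamma> * q) * ((1 + \<gamma>)\<^sup>2 - (1 - q) * \<gamma> * x\<^sup>2) *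
       (\<Sum>k. expansion_term x (\<gamma> * q) q k))"
    by (intro sums_mult summable_sums summable_expansion_term q gq)
  ultimately show ?thesis
    unfolding expansion_term_shift[OF q g] by (rule sums_unique2[symmetric])
qed

text \<open>Each use of \<open>expansion_sum_shift\<close> at \<open>\<gamma> * q ^ n\<close> adds
  one factor to each product on the left. On the right it adds two factors, since squaring turns
  \<open>q ^ n\<close> into \<open>q ^ (2 * n)\<close>; hence the index 2n.\<close>

lemma expansion_sum_iterate:
  assumes q: "\<bar>q\<bar> < 1" and g: "\<bar>\<gamma>\<bar> < 1"
  shows "q_poch q \<gamma> n * q_poch q (\<gamma> * q) n *
      (\<Prod>i<n. (1 + \<gamma> * q ^ i)\<^sup>2 - (1 - q) * \<gamma> * x\<^sup>2 * q ^ i) *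
      (\<Sum>k. expansion_term x (\<gamma> * q ^ n) q k) =
    q_poch q (\<gamma>\<^sup>2) (2 * n) * (\<Sum>k. expansion_term x \<gamma> q k)"
proof (induction n)
  case 0
  show ?case by (simp add: q_poch_def)
next
  case (Suc n)
  define h where "h = \<gamma> * q ^ n"
  define P where "P = (\<Prod>i<n. (1 + \<gamma> * q ^ i)\<^sup>2 - (1 - q) * \<gamma> * x\<^sup>2 * q ^ i)"
  have h: "\<bar>h\<bar> < 1"
    unfolding h_def by (rule abs_mult_power_less_one[OF q g])
  have h2: "h\<^sup>2 = \<gamma>\<^sup>2 * q ^ (2 * n)"
    by (simp add: h_def power_mult_distrib mult.commute flip: power_mult)
  have "q_poch q \<gamma> (Suc n) * q_poch q (\<gamma> * q) (Suc n) *
      (\<Prod>i<Suc n. (1 + \<gamma> * q ^ i)\<^sup>2 - (1 - q) * \<gamma> * x\<^sup>2 * q ^ i) *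
      (\<Sum>k. expansion_term x (\<gamma> * q ^ Suc n) q k) =
      q_poch q \<gamma> n * q_poch q (\<gamma> * q) n * P *
      ((1 - h) * (1 - h * q) * ((1 + h)\<^sup>2 - (1 - q) * h * x\<^sup>2) * (\<Sum>k. expansion_term x (h * q) q k))"
    by (simp add: q_poch_Suc P_def h_def mult_ac)
  also have "\<dots> = q_poch q \<gamma> n * q_poch q (\<gamma> * q) n * P * (\<Sum>k. expansion_term x h q k) *
      ((1 - h\<^sup>2) * (1 - h\<^sup>2 * q))"
    unfolding expansion_sum_shift[OF q h] by (simp add: mult_ac)
  also have "\<dots> = q_poch q (\<gamma>\<^sup>2) (2 * Suc n) * (\<Sum>k. expansion_term x \<gamma> q k)"
    using Suc.IH by (simp add: P_def h_def[symmetric] h2 q_poch_Suc mult_ac)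
  finally show ?case .
qed

section \<open>Convergence and nonvanishing of the infinite products\<close>

lemma prod_lessThan_tendsto_prodinf:
  fixes f :: "nat \<Rightarrow> real"
  assumes "convergent_prod f"
  shows "(\<lambda>n. \<Prod>i<n. f i) \<longlonglongrightarrow> prodinf f"
  using convergent_prod_LIMSEQ[OF assms]
  by (subst filterlim_sequentially_Suc[symmetric]) (simp only: lessThan_Suc_atMost)

text \<open>One criterion for all products involved: b = 0 gives the q-Pochhammer factors, and
  expanding the square gives the density factors.\<close>

lemma convergent_prod_quadratic_geometric:
  fixes a b q :: real
  assumes q: "\<bar>q\<bar> < 1"
  shows "convergent_prod (\<lambda>k. 1 + a * q ^ k + b * (q ^ k)\<^sup>2)"
proof -
  have "summable (\<lambda>k. norm (1 + a * q ^ k + b * (q ^ k)\<^sup>2 - 1))"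
  proof (rule summable_comparison_test')
    show "summable (\<lambda>k. (\<bar>a\<bar> + \<bar>b\<bar>) * \<bar>q\<bar> ^ k)"
      using q by (intro summable_mult summable_geometric) auto
    fix k
    have "\<bar>q\<bar> ^ k * \<bar>q\<bar> ^ k \<le> \<bar>q\<bar> ^ k * 1"
      using q by (intro mult_left_mono power_le_one) auto
    then have "\<bar>b\<bar> * (\<bar>q\<bar> ^ k * \<bar>q\<bar> ^ k) \<le> \<bar>b\<bar> * \<bar>q\<bar> ^ k"
      by (intro mult_left_mono) auto
    then have "\<bar>a * q ^ k\<bar> + \<bar>b * (q ^ k)\<^sup>2\<bar> \<le> (\<bar>a\<bar> + \<bar>b\<bar>) * \<bar>q\<bar> ^ k"
      by (simp add: abs_mult power_abs power2_eq_square algebra_simps)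
    then show "norm (norm (1 + a * q ^ k + b * (q ^ k)\<^sup>2 - 1)) \<le> (\<bar>a\<bar> + \<bar>b\<bar>) * \<bar>q\<bar> ^ k"
      using abs_triangle_ineq[of "a * q ^ k" "b * (q ^ k)\<^sup>2"] by simp
  qed
  then show ?thesis
    by (intro abs_convergent_prod_imp_convergent_prod summable_imp_abs_convergent_prod)
qed

lemma convergent_prod_q_poch:
  assumes "\<bar>q\<bar> < 1" shows "convergent_prod (\<lambda>i. 1 - a * q ^ i :: real)"
  using convergent_prod_quadratic_geometric[OF assms, of "- a" 0] by simp

lemma convergent_prod_density:
  fixes a c q :: real
  assumes "\<bar>q\<bar> < 1" shows "convergent_prod (\<lambda>k. (1 + a * q ^ k)\<^sup>2 - c * q ^ k)"
  using convergent_prod_quadratic_geometric[OF assms, of "2 * a - c" "a\<^sup>2"]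
  by (simp add: power2_sum power_mult_distrib algebra_simps)

lemma q_poch_tendsto: "\<bar>q\<bar> < 1 \<Longrightarrow> q_poch q a \<longlonglongrightarrow> q_poch_inf q a"
  unfolding q_poch_def[abs_def] q_poch_inf_def
  by (intro prod_lessThan_tendsto_prodinf convergent_prod_q_poch)

lemma q_poch_inf_nonzero:
  assumes "\<bar>q\<bar> < 1" "\<bar>a\<bar> < 1" shows "q_poch_inf q a \<noteq> 0"
proof -
  have "1 - a * q ^ i \<noteq> 0" for i
    using abs_mult_power_less_one[OF assms, of i] by auto
  then show ?thesis
    unfolding q_poch_inf_def by (intro prodinf_nonzero convergent_prod_q_poch assms)
qed

text \<open>For b >= 0 the expression is at least \<open>(1 - b)\<^sup>2\<close>; for b < 0 the
  subtracted term is not positive. With b = \<gamma> q^k and c = (1 - q) x^2 this keeps the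
  denominators in \<open>f_R\<close> away from 0.\<close>

lemma square_one_plus_minus_pos:
  fixes b c :: real
  assumes "\<bar>b\<bar> < 1" "0 \<le> c" "c < 4"
  shows "0 < (1 + b)\<^sup>2 - c * b"
proof (cases "0 \<le> b")
  case True
  then have "c * b \<le> 4 * b"
    using assms by (intro mult_right_mono) auto
  moreover have "0 < (1 - b)\<^sup>2"
    using assms by simp
  ultimately show ?thesis by (simp add: power2_eq_square algebra_simps)
next
  case False
  then have "c * b \<le> 0" and "0 < (1 + b)\<^sup>2"
    using assms by (auto simp: mult_nonneg_nonpos)
  then show ?thesis by linarith
qed

section \<open>Passage to the limit and comparison of the densities\<close>

theorem mainTheorem5:
  fixes q \<gamma> x :: real
  assumes "\<bar>q\<bar> < 1" and "\<bar>\<gamma>\<bar> < 1" and "\<bar>x\<bar> < 2 / sqrt (1 - q)"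
  shows "summable (\<lambda>k. expansion_term x \<gamma> q k) \<and>
         f_N x q = f_R x \<gamma> q * (\<Sum>k. expansion_term x \<gamma> q k)"
proof
  note q = assms(1) and g = assms(2)
  show "summable (\<lambda>k. expansion_term x \<gamma> q k)"
    using summable_expansion_term[OF q g] .
  define S where "S = (\<Sum>k. expansion_term x \<gamma> q k)"
  define N where "N k = (1 + q ^ k)\<^sup>2 - (1 - q) * x\<^sup>2 * q ^ k" for k
  define D where "D k = (1 + \<gamma> * q ^ k)\<^sup>2 - (1 - q) * \<gamma> * x\<^sup>2 * q ^ k" for k
  have gq: "\<bar>\<gamma> * q\<bar> < 1" and g2: "\<bar>\<gamma>\<^sup>2\<bar> < 1"
    using abs_mult_power_less_one[OF q g, of 1] abs_square_mult_power_less_one[OF q g, of 0] by auto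
  have N: "convergent_prod N" and D: "convergent_prod D"
    using convergent_prod_density[OF q, of 1 "(1 - q) * x\<^sup>2"]
      convergent_prod_density[OF q, of \<gamma> "(1 - q) * \<gamma> * x\<^sup>2"]
    by (simp_all add: N_def[abs_def] D_def[abs_def])
  have "\<bar>x\<bar> * sqrt (1 - q) < 2"
    using assms(3) q by (simp add: field_simps)
  then have "(\<bar>x\<bar> * sqrt (1 - q))\<^sup>2 < 2\<^sup>2"
    using q by (intro power_strict_mono) auto
  then have x: "(1 - q) * x\<^sup>2 < 4"
    using q by (simp add: power_mult_distrib mult.commute)
  have "D k \<noteq> 0" for k
    using square_one_plus_minus_pos[OF abs_mult_power_less_one[OF q g, of k], of "(1 - q) * x\<^sup>2"] x q
    by (simp add: D_def mult_ac)
  then have D_nz: "prodinf D \<noteq> 0"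
    by (intro prodinf_nonzero D)
  have nz: "q_poch_inf q \<gamma> \<noteq> 0" "q_poch_inf q (\<gamma> * q) \<noteq> 0" "q_poch_inf q (\<gamma>\<^sup>2) \<noteq> 0"
    by (intro q_poch_inf_nonzero q g gq g2)+
  have "(\<lambda>n. q_poch q (\<gamma>\<^sup>2) (2 * n)) \<longlonglongrightarrow> q_poch_inf q (\<gamma>\<^sup>2)"
    using LIMSEQ_subseq_LIMSEQ[OF q_poch_tendsto[OF q, of "\<gamma>\<^sup>2"], of "\<lambda>n. 2 * n"]
    by (simp add: strict_mono_def o_def)
  then have "(\<lambda>n. q_poch q (\<gamma>\<^sup>2) (2 * n) * S) \<longlonglongrightarrow> q_poch_inf q (\<gamma>\<^sup>2) * S"
    by (intro tendsto_intros)
  \<comment> \<open>A second limit of the same sequence, rewritten by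
    \<open>expansion_sum_iterate\<close>; the final factor 1 is the limit of the shifted series.
    Uniqueness of limits then evaluates \<open>S\<close>.\<close>
  moreover have "(\<lambda>n. q_poch q (\<gamma>\<^sup>2) (2 * n) * S) \<longlonglongrightarrow>
      q_poch_inf q \<gamma> * q_poch_inf q (\<gamma> * q) * prodinf D * 1"
    unfolding S_def expansion_sum_iterate[OF q g, symmetric] D_def[symmetric]
    by (intro tendsto_mult q_poch_tendsto q prod_lessThan_tendsto_prodinf D
        expansion_sum_tendsto_one g)
  ultimately have key: "q_poch_inf q (\<gamma>\<^sup>2) * S = q_poch_inf q \<gamma> * q_poch_inf q (\<gamma> * q) * prodinf D"
    using LIMSEQ_unique by fastforce
  \<comment> \<open>The prefactor common to both densities. The remaining constants of
    \<open>f_R\<close>, together with \<open>S\<close>, cancel against \<open>prodinf D\<close> by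
    \<open>key\<close>.\<close>
  define A where "A = sqrt (1 - q) * q_poch_inf q q / (2 * pi * sqrt (4 - (1 - q) * x\<^sup>2))"
  have "f_R x \<gamma> q * S = A / (q_poch_inf q \<gamma> * q_poch_inf q (\<gamma> * q)) * (prodinf N / prodinf D) *
      (q_poch_inf q (\<gamma>\<^sup>2) * S)"
    unfolding prodinf_divide[OF N D] unfolding f_R_def A_def N_def D_def by simp (simp only: mult_ac)
  also have "\<dots> = A * prodinf N"
    unfolding key using nz D_nz by simp
  also have "\<dots> = f_N x q"
    by (simp add: f_N_def A_def N_def[abs_def])
  finally show "f_N x q = f_R x \<gamma> q * (\<Sum>k. expansion_term x \<gamma> q k)"
    by (simp add: S_def)
qed

end
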